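(* Suppose that $q\equiv\pm1\pmod{24}$, so that $2$ and $3$ are squares in $\mathbb{F}_q$. Set $c=(2+\sqrt3)/4\in\mathbb{F}_q$ for either choice of the square root $\sqrt3\in\mathbb{F}_q$. Then $c\in\mathcal{C}$, and for $s\in\mathbb{F}_q$ with $1-s^2=c$, each monic irreducible factor $I(y)$ of $g_s(y)$ over $\mathbb{F}_q$ has the form $$y^{12}-6y^{11}+\frac{63}{4}y^{10}-\frac{95}{4}y^9+\frac{2907}{128}y^8-\frac{459}{32}y^7+\frac{1547}{256}y^6-\frac{429}{256}y^5+\frac{19305}{65536}y^4-\frac{1001}{32768}y^3+\frac{429}{262144}y^2-\frac{9}{262144}y-m$$ for some $m\in\mathbb{F}_q$.
   Context: $\mathbb{F}_q$ is a finite field with $q$ elements, $q$ a power of an odd prime; $n=(q+1)/2$; for $s\in\mathbb{F}_q$, $g_s(y) := y^n+(1-y)^n-s \in \mathbb{F}_q[y]$. $\rho$ is the quadratic character on $\mathbb{F}_q$ and $\mathcal{C} := \{a \in \mathbb{F}_q : \rho(a)=\rho(1-a)=1\}$. *)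

theory Defs
  imports
    "HOL-Library.Cardinality"
    "HOL-Computational_Algebra.Computational_Algebra"
    "HOL-Number_Theory.Cong"
begin

text \<open>
  The field \<open>\<F>\<^sub>q\<close> is an arbitrary type \<open>'a\<close> of class \<^class>\<open>finite_field\<close>, with \<open>q = CARD('a)\<close>.
\<close>

definition quadratic_character :: "'a::finite_field \<Rightarrow> int" where
  "quadratic_character a = (if a = 0 then 0 else if \<exists>b. b\<^sup>2 = a then 1 else - 1)"

definition C_set :: "'a::finite_field set" where
  "C_set = {a. quadratic_character a = 1 \<and> quadratic_character (1 - a) = 1}"

text \<open>
  \<open>y\<^sup>n + (1 - y)\<^sup>n - s\<close> with \<open>n = (q + 1)/2\<close>; the division is exact for odd \<open>q\<close>,
  the only case of interest.
\<close>
definition g_poly :: "'a::finite_field \<Rightarrow> 'a poly" where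
  "g_poly s = (let n = (CARD('a) + 1) div 2; y = [:0, 1:] in y ^ n + (1 - y) ^ n - [:s:])"

end

theory Submission
  imports "HOL-Algebra.Algebraic_Closure_Type" Defs
begin

text \<open>
  Over an algebraic closure every element is \<open>y = (2 + w + 1/w)/4\<close> for some nonzero \<open>w = e\<^sup>2\<close>,
  that is, \<open>y = cos\<^sup>2 \<theta>\<close> with \<open>e = exp (i\<theta>)\<close>. In characteristic \<open>p\<close> the map \<open>x \<mapsto> x\<^sup>q\<close> is additive,
  so \<open>y\<^sup>n + (1 - y)\<^sup>n = cos \<theta> cos\<^sup>q \<theta> + sin \<theta> sin\<^sup>q \<theta>\<close> (up to a sign) collapses by the addition
  theorem to the cosine of a single angle: it is \<open>(z + 1/z)/2\<close>, where \<open>e\<^sup>q\<close> equals \<open>z e\<close> for odd \<open>n\<close>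
  and \<open>1/(z e)\<close> for even \<open>n\<close> (\<open>sum_of_powers_at_cosq_square\<close>).

  So \<open>y\<close> is a root of \<open>g\<^sub>s\<close> exactly if \<open>z + 1/z = 2s\<close>. For \<open>1 - s\<^sup>2 = (2 + \<surd>3)/4\<close>, which is the case of
  the cosines of 75 and 105 degrees (or of 15 and 165 for the other \<open>\<surd>3\<close>), this makes \<open>z\<close> a
  primitive 24th root of unity and \<open>\<eta> = z\<^sup>2\<close> one of order 12. As \<open>w\<^sup>q\<close> is \<open>\<eta>w\<close> or its inverse, and \<open>\<eta>\<^sup>q\<close> is correspondingly \<open>\<eta>\<close> or its
  inverse, the map \<open>x \<mapsto> x\<^sup>q\<close> moves the parameter of a conjugate of \<open>y\<close> from \<open>w\<close> to \<open>\<eta>w\<close>, \<open>\<eta>\<^sup>2w\<close>, and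
  so on, and \<open>y\<close> has 12 distinct conjugates. Hence no nonzero polynomial over \<open>\<F>\<^sub>q\<close> of degree
  below 12 vanishes at \<open>y\<close> (\<open>degree_ge_12_if_root\<close>).

  On the other hand \<open>w\<^sup>1\<^sup>2 + w\<^sup>-\<^sup>1\<^sup>2\<close> is fixed by \<open>x \<mapsto> x\<^sup>q\<close> because \<open>\<eta>\<^sup>1\<^sup>2 = 1\<close>, so it lies in \<open>\<F>\<^sub>q\<close>. It is
  also the Dickson (rescaled Chebyshev) polynomial of degree 12 in \<open>w + 1/w = 4y - 2\<close>.
  Subtracting the value from that polynomial and dividing by \<open>4\<^sup>1\<^sup>2\<close> gives a monic polynomial of
  degree 12 over \<open>\<F>\<^sub>q\<close> that vanishes at \<open>y\<close>, which is therefore the minimal polynomial of \<open>y\<close>; its coefficients are the ones in the theorem, and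
  only the constant term depends on \<open>y\<close>.
\<close>

section \<open>Powers with exponent the size of the field\<close>

text \<open>
  Translation by 1 permutes the field, so it does not change the sum of all elements.
\<close>

lemma of_nat_CARD_eq_0: "of_nat (CARD('a)) = (0 :: 'a::finite_field)"
proof -
  have "(\<Sum>x\<in>(UNIV::'a set). x) = (\<Sum>x\<in>(UNIV::'a set). x + 1)"
    by (rule sum.reindex_bij_witness[of _ "\<lambda>x. x + 1" "\<lambda>x. x - 1"]) auto
  thus ?thesis by (simp add: sum.distrib)
qed

lemma CARD_ge_2: "CARD('a::finite_field) \<ge> 2"
  using card_mono[of UNIV "{0, 1 :: 'a}"] by simp

lemma to_ac_pow_card: "to_ac (c :: 'a::finite_field) ^ CARD('a) = to_ac c"
  by (metis finite_field_power_card_eq_same to_ac_power)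

lemma card_range_to_ac: "card (range (to_ac :: 'a::finite_field \<Rightarrow> _)) = CARD('a)"
  by (simp add: card_image inj_to_ac)

text \<open>
  The two sides, as polynomials in \<open>x\<close>, are monic of degree \<open>q\<close>, so they are equal as soon as they
  agree at the \<open>q\<close> elements of the base field. This gives the additivity of \<open>x \<mapsto> x\<^sup>q\<close>
  without writing \<open>q\<close> as a power of the characteristic.
\<close>

lemma pow_card_addI:
  fixes z :: "'a::finite_field alg_closure"
  assumes "\<And>c :: 'a. (to_ac c + z) ^ CARD('a) = to_ac c + z ^ CARD('a)"
  shows "(x + z) ^ CARD('a) = x ^ CARD('a) + z ^ CARD('a)"
proof -
  let ?q = "CARD('a)"
  have q0: "?q > 0" by simp
  have "[:z, 1:] ^ ?q = monom 1 ?q + [:z ^ ?q:]"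
  proof (rule poly_eqI_degree_lead_coeff[where A = "range (to_ac :: 'a \<Rightarrow> _)" and n = ?q])
    have deg: "degree ([:z, 1:] ^ ?q) = ?q"
      by (simp add: degree_power_eq)
    show "degree ([:z, 1:] ^ ?q) \<le> ?q"
      using deg by simp
    show "coeff ([:z, 1:] ^ ?q) ?q = coeff (monom 1 ?q + [:z ^ ?q:]) ?q"
      using lead_coeff_power[of "[:z, 1:]" ?q] q0 deg
      by (simp add: coeff_pCons split: nat.splits)
    show "?q \<le> card (range (to_ac :: 'a \<Rightarrow> _))"
      by (simp add: card_range_to_ac)
    show "degree (monom 1 ?q + [:z ^ ?q:]) \<le> ?q"
      by (intro degree_add_le degree_monom_le) auto
    show "poly ([:z, 1:] ^ ?q) t = poly (monom 1 ?q + [:z ^ ?q:]) t"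
      if "t \<in> range to_ac" for t
      using that assms by (auto simp: poly_monom to_ac_pow_card add.commute)
  qed
  hence "poly ([:z, 1:] ^ ?q) x = poly (monom 1 ?q + [:z ^ ?q:]) x" by simp
  thus ?thesis by (simp add: poly_monom add.commute)
qed

text \<open>
  Two applications of the interpolation argument: if one summand is in the base field, then the
  hypothesis of \<open>pow_card_addI\<close> is additivity inside the base field; the result is in turn
  that hypothesis for two arbitrary summands.
\<close>

lemma pow_card_add:
  fixes x y :: "'a::finite_field alg_closure"
  shows "(x + y) ^ CARD('a) = x ^ CARD('a) + y ^ CARD('a)"
proof -
  have *: "(x + to_ac c) ^ CARD('a) = x ^ CARD('a) + to_ac c" for x and c :: 'a
    using pow_card_addI[of "to_ac c" x]
    by (metis to_ac_add to_ac_pow_card)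
  show ?thesis
    by (rule pow_card_addI) (metis * add.commute)
qed

lemma pow_card_diff:
  fixes x y :: "'a::finite_field alg_closure"
  shows "(x - y) ^ CARD('a) = x ^ CARD('a) - y ^ CARD('a)"
  using pow_card_add[of "x - y" y] by simp

lemma numeral_pow_card: "(numeral k :: 'a::finite_field alg_closure) ^ CARD('a) = numeral k"
  using to_ac_pow_card[of "numeral k :: 'a"] by simp

text \<open>
  The polynomial \<open>X\<^sup>q - X\<close> already has \<open>q\<close> roots in the base field, which leaves no room for
  another one.
\<close>

lemma in_range_to_ac_if_pow_card_eq:
  fixes x :: "'a::finite_field alg_closure"
  assumes "x ^ CARD('a) = x"
  shows "x \<in> range to_ac"
proof (rule ccontr)
  assume nx: "x \<notin> range to_ac"
  let ?q = "CARD('a)"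
  have q2: "?q \<ge> 2" by (rule CARD_ge_2)
  let ?A = "insert x (range (to_ac :: 'a \<Rightarrow> _))"
  have "(monom 1 ?q :: 'a alg_closure poly) = [:0, 1:]"
  proof (rule poly_eqI_degree[where A = ?A])
    show "poly (monom 1 ?q) t = poly [:0, 1:] t" if "t \<in> ?A" for t
      using that assms by (auto simp: poly_monom to_ac_pow_card)
    have "card ?A = Suc ?q"
      using nx card_range_to_ac[where 'a = 'a] by (subst card_insert_disjoint) auto
    thus "degree (monom (1 :: 'a alg_closure) ?q) < card ?A"
      "degree [:0, 1 :: 'a alg_closure:] < card ?A"
      using q2 by (auto simp: degree_monom_eq)
  qed
  hence "degree (monom 1 ?q :: 'a alg_closure poly) = degree [:0, 1 :: 'a alg_closure:]" by simp
  thus False using q2 by (simp add: degree_monom_eq)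
qed

section \<open>Polynomials over the base field evaluated in the algebraic closure\<close>

lemma map_poly_to_ac_pCons [simp]:
  "map_poly to_ac (pCons a p) = pCons (to_ac a) (map_poly to_ac p)"
  by (simp add: map_poly_pCons)

lemma map_poly_to_ac_add [simp]:
  "map_poly to_ac (p + q) = map_poly to_ac p + map_poly to_ac q"
  by (intro poly_eqI) (simp add: coeff_map_poly)

lemma map_poly_to_ac_diff [simp]:
  "map_poly to_ac (p - q) = map_poly to_ac p - map_poly to_ac q"
  by (intro poly_eqI) (simp add: coeff_map_poly)

lemma map_poly_to_ac_mult [simp]:
  "map_poly to_ac (p * q) = map_poly to_ac p * map_poly to_ac q"
  by (induction p) (simp_all add: map_poly_smult)

lemma map_poly_to_ac_power [simp]: "map_poly to_ac (p ^ n) = map_poly to_ac p ^ n"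
  by (induction n) simp_all

lemma degree_map_poly_to_ac [simp]: "degree (map_poly to_ac p) = degree p"
  by (rule degree_map_poly) simp

lemma map_poly_to_ac_eq_0_iff [simp]: "map_poly to_ac p = 0 \<longleftrightarrow> p = 0"
  by (simp add: map_poly_eq_0_iff)

lemma poly_pow_card:
  fixes p :: "'a::finite_field poly"
  shows "poly (map_poly to_ac p) (x ^ CARD('a)) = poly (map_poly to_ac p) x ^ CARD('a)"
proof (induction p)
  case (pCons a p)
  show ?case
    using pCons.IH by (simp add: pow_card_add power_mult_distrib to_ac_pow_card)
qed (simp add: power_0_left)

text \<open>
  The remainder of \<open>I\<close> modulo \<open>Q\<close> vanishes at the common root and has a degree below the minimal
  one, so it is 0, and irreducibility leaves only a constant cofactor.
\<close>

lemma eq_if_common_root_of_min_degree: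
  fixes I Q :: "'a::field poly"
  assumes I: "Factorial_Ring.irreducible I" "lead_coeff I = 1"
    and Q: "lead_coeff Q = 1" "degree Q > 0"
    and root: "poly (map_poly to_ac I) y = 0" "poly (map_poly to_ac Q) y = 0"
    and min: "\<And>p :: 'a poly. p \<noteq> 0 \<Longrightarrow> poly (map_poly to_ac p) y = 0 \<Longrightarrow> degree Q \<le> degree p"
  shows "I = Q"
proof -
  have Q0: "Q \<noteq> 0" using Q by auto
  have "I = Q * (I div Q) + I mod Q" by simp
  hence "poly (map_poly to_ac I) y =
    poly (map_poly to_ac Q) y * poly (map_poly to_ac (I div Q)) y + poly (map_poly to_ac (I mod Q)) y"
    by (metis map_poly_to_ac_add map_poly_to_ac_mult poly_add poly_mult)
  hence "poly (map_poly to_ac (I mod Q)) y = 0" using root by simp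
  hence "I mod Q = 0"
    using min[of "I mod Q"] degree_mod_less[OF Q0, of I] by force
  then obtain u where u: "I = Q * u" by auto
  have "\<not> is_unit Q" using Q Q0 by (simp add: is_unit_iff_degree)
  hence "is_unit u" using I(1) u by (auto dest: irreducibleD)
  then obtain c where c: "u = [:c:]" by (meson is_unit_polyE)
  have "c = 1" using I(2) Q(1) u c by (auto simp: lead_coeff_smult split: if_splits)
  thus ?thesis using u c by (simp add: one_pCons[symmetric])
qed

section \<open>The parametrization of the roots\<close>

lemma four_neq_0:
  assumes "(2::'a::idom) \<noteq> 0"
  shows "(4::'a) \<noteq> 0"
  using power_not_zero[OF assms, of 2] by simp

text \<open>
  If \<open>u = exp (2i\<theta>)\<close>, then \<open>cosq u\<close> is \<open>cos\<^sup>2 \<theta>\<close>.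
\<close>

definition cosq :: "'a::field \<Rightarrow> 'a" where
  "cosq u = (2 + u + 1 / u) / 4"

lemma cosq_inverse: "cosq (1 / u) = cosq u"
  by (simp add: cosq_def add_ac)

lemma cosq_eq_iff:
  assumes "(2::'a::field) \<noteq> 0" and "u \<noteq> 0" and "v \<noteq> 0"
  shows "cosq u = cosq (v :: 'a) \<longleftrightarrow> u = v \<or> u * v = 1"
proof -
  have 4: "(4::'a) \<noteq> 0" by (rule four_neq_0[OF assms(1)])
  have "cosq u = cosq v \<longleftrightarrow> u + 1 / u = v + 1 / v"
    using divide_cancel_right[of "2 + u + 1 / u" 4 "2 + v + 1 / v"] 4
    by (simp only: cosq_def add.assoc add_left_cancel simp_thms)
  also have "\<dots> \<longleftrightarrow> (u - v) * (u * v - 1) = 0"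
    using assms(2,3) by (simp add: field_simps)
  finally show ?thesis by auto
qed

lemma cosq_pow_card:
  fixes u :: "'a::finite_field alg_closure"
  shows "cosq u ^ CARD('a) = cosq (u ^ CARD('a))"
  by (simp add: cosq_def power_divide pow_card_add numeral_pow_card)

text \<open>
  Solve \<open>(e + 1/e)/2 = z\<close> for \<open>e\<close>, where \<open>z\<close> is a square root of \<open>y\<close>.
\<close>

lemma exists_cosq_square:
  fixes y :: "'a::alg_closed_field"
  assumes "(2::'a) \<noteq> 0"
  obtains e where "e \<noteq> 0" and "y = cosq (e\<^sup>2)"
proof -
  have 4: "(4::'a) \<noteq> 0" by (rule four_neq_0[OF assms])
  obtain z where z: "poly [:-y, 0, 1:] z = 0"
    using alg_closed_imp_poly_has_root[of "[:-y, 0, 1:]"] by auto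
  obtain e where e: "poly [:1, - 2 * z, 1:] e = 0"
    using alg_closed_imp_poly_has_root[of "[:1, - 2 * z, 1:]"] by auto
  have e0: "e \<noteq> 0" using e by auto
  have ze: "y = z * z" "1 + e * e = 2 * z * e" using z e by (simp_all add: algebra_simps)
  have "4 * y * e\<^sup>2 = 2 * e\<^sup>2 + e\<^sup>2 * e\<^sup>2 + 1" using ze by Groebner_Basis.algebra
  hence "y = cosq (e\<^sup>2)"
    using e0 4 by (simp add: cosq_def field_simps)
  thus ?thesis using that e0 by blast
qed

text \<open>
  With \<open>a = (e + 1/e)/2\<close> and \<open>b = (e - 1/e)/2\<close> one has \<open>y = a\<^sup>2\<close> and \<open>1 - y = - b\<^sup>2\<close>. Since \<open>2n = q + 1\<close>,
  the \<open>n\<close>-th powers are \<open>a\<cdot>a\<^sup>q\<close> and \<open>(-1)\<^sup>n b\<cdot>b\<^sup>q\<close>, and \<open>a\<^sup>q\<close>, \<open>b\<^sup>q\<close> come from \<open>a\<close>, \<open>b\<close> by replacing \<open>e\<close> with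
  \<open>E = e\<^sup>q\<close>. The sign \<open>(-1)\<^sup>n\<close> decides which of the mixed terms cancel.
\<close>

lemma sum_of_powers_at_cosq_square:
  fixes e :: "'a::finite_field alg_closure"
  assumes 2: "(2 :: 'a alg_closure) \<noteq> 0" and n: "2 * n = CARD('a) + 1" and e: "e \<noteq> 0"
  defines "y \<equiv> cosq (e\<^sup>2)" and "E \<equiv> e ^ CARD('a)"
  shows "2 * (y ^ n + (1 - y) ^ n) = (if even n then e * E + 1 / (e * E) else e / E + E / e)"
proof -
  have 4: "(4::'a alg_closure) \<noteq> 0" by (rule four_neq_0[OF 2])
  have E: "E \<noteq> 0" using e by (simp add: E_def)
  have pow: "(z\<^sup>2) ^ n = z * z ^ CARD('a)" for z :: "'a alg_closure"
    by (simp add: power_mult[symmetric] n)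
  (* Naming the inverses of e, E and 2 turns the identities below into polynomial ones. *)
  define f and F and h where "f = 1 / e" and "F = 1 / E" and "h = 1 / (2 :: 'a alg_closure)"
  note defs = this
  have inv: "e * f = 1" "E * F = 1" "2 * h = 1" using e E 2 by (simp_all add: defs)
  have Fq: "f ^ CARD('a) = F" "h ^ CARD('a) = h"
    by (simp_all add: defs E_def power_divide numeral_pow_card)
  have "4 * h\<^sup>2 = (2 * h)\<^sup>2" by (simp add: power_mult_distrib)
  hence h2: "4 * h\<^sup>2 = 1" unfolding inv by simp
  hence "h\<^sup>2 = 1 / 4" using 4 by (simp add: eq_divide_eq mult.commute)
  hence y: "y = (2 + e\<^sup>2 + f\<^sup>2) * h\<^sup>2"
    by (simp add: y_def cosq_def defs(1) power_divide)
  have "y = ((e + f) * h)\<^sup>2" unfolding y using inv(1) by Groebner_Basis.algebra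
  hence yn: "y ^ n = ((e + f) * h) * ((E + F) * h)"
    by (simp only: pow) (simp only: power_mult_distrib pow_card_add Fq E_def[symmetric])
  have "1 - y = - 1 * ((e - f) * h)\<^sup>2" unfolding y using inv(1) h2 by Groebner_Basis.algebra
  hence "(1 - y) ^ n = (- 1) ^ n * (((e - f) * h)\<^sup>2) ^ n"
    by (metis power_mult_distrib)
  hence y1n: "(1 - y) ^ n = (- 1) ^ n * (((e - f) * h) * ((E - F) * h))"
    by (simp only: pow) (simp only: power_mult_distrib pow_card_diff Fq E_def[symmetric])
  show ?thesis
  proof (cases "even n")
    case True
    have "2 * (((e + f) * h) * ((E + F) * h) + ((e - f) * h) * ((E - F) * h)) = e * E + f * F"
      using h2 by Groebner_Basis.algebra
    thus ?thesis using True by (simp add: yn y1n) (simp add: defs)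
  next
    case False
    have "2 * (((e + f) * h) * ((E + F) * h) - ((e - f) * h) * ((E - F) * h)) = e * F + E * f"
      using h2 by Groebner_Basis.algebra
    thus ?thesis using False by (simp add: yn y1n) (simp add: defs)
  qed
qed

section \<open>Primitive roots of unity of order 12 and 24\<close>

text \<open>
  The 12th cyclotomic polynomial is \<open>X\<^sup>4 - X\<^sup>2 + 1\<close>, so outside characteristic 2 and 3 the hypothesis
  says that \<open>\<eta>\<close> is a primitive 12th root of unity.
\<close>

lemma cyclotomic_12_power:
  fixes \<eta> :: "'a::field"
  assumes "\<eta> ^ 4 - \<eta>\<^sup>2 + 1 = 0"
  shows "\<eta> ^ 6 = - 1" "\<eta> ^ 12 = 1"
proof -
  show 6: "\<eta> ^ 6 = - 1" using assms by Groebner_Basis.algebra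
  thus "\<eta> ^ 12 = 1" by Groebner_Basis.algebra
qed

text \<open>
  Every proper divisor of 12 divides 4 or 6, and \<open>\<eta>\<^sup>4 = 1\<close> forces \<open>3 = 0\<close>, while \<open>\<eta>\<^sup>6 = 1\<close> forces
  \<open>2 = 0\<close>.
\<close>

lemma cyclotomic_12_power_neq_1:
  fixes \<eta> :: "'a::field"
  assumes cyc: "\<eta> ^ 4 - \<eta>\<^sup>2 + 1 = 0" and 2: "(2::'a) \<noteq> 0" and 3: "(3::'a) \<noteq> 0"
    and k: "0 < k" "k < 12"
  shows "\<eta> ^ k \<noteq> 1"
proof
  assume 1: "\<eta> ^ k = 1"
  have mod: "\<eta> ^ m = \<eta> ^ (m mod 12)" for m
  proof -
    have "\<eta> ^ m = \<eta> ^ (12 * (m div 12) + m mod 12)" by simp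
    also have "\<dots> = (\<eta> ^ 12) ^ (m div 12) * \<eta> ^ (m mod 12)"
      by (simp only: power_add power_mult)
    finally show ?thesis by (simp add: cyclotomic_12_power[OF cyc])
  qed
  (* gcd k 12 divides 4 or 6, so some multiple of k is 4 or 6 modulo 12. *)
  have "k \<in> {1,2,3,4,5,6,7,8,9,10,11}" using k by (simp; presburger)
  hence "\<exists>m. k * m mod 12 = 4 \<or> k * m mod 12 = 6"
    by (auto intro: exI[of _ 1] exI[of _ 2] exI[of _ 4] exI[of _ 6] exI[of _ 8])
  then obtain m where m: "k * m mod 12 = 4 \<or> k * m mod 12 = 6" by blast
  have "\<eta> ^ (k * m) = 1" using 1 by (simp add: power_mult)
  hence "\<eta> ^ 4 = 1 \<or> \<eta> ^ 6 = 1" using m mod[of "k * m"] by auto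
  thus False
  proof
    assume "\<eta> ^ 4 = 1"
    hence sq: "\<eta>\<^sup>2 = 2" using cyc by (simp add: algebra_simps)
    have "(\<eta>\<^sup>2)\<^sup>2 = \<eta> ^ 4" by simp
    hence "(4::'a) = 1" using \<open>\<eta> ^ 4 = 1\<close> unfolding sq by simp
    hence "(3::'a) = 0" using add_right_cancel[of 3 1 "0::'a"] by simp
    thus False using 3 by simp
  next
    assume "\<eta> ^ 6 = 1"
    hence "(- 1 :: 'a) = 1" using cyclotomic_12_power(1)[OF cyc] by simp
    thus False using 2 by (metis add.left_inverse one_add_one)
  qed
qed

lemma power_cong_24:
  fixes z :: "'a::field"
  assumes "z ^ 24 = 1"
  shows "q mod 24 = 1 \<Longrightarrow> z ^ q = z" and "q mod 24 = 23 \<Longrightarrow> z ^ q = 1 / z"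
proof -
  have mod: "z ^ q = z ^ (q mod 24)"
  proof -
    have "z ^ q = z ^ (24 * (q div 24) + q mod 24)" by simp
    also have "\<dots> = (z ^ 24) ^ (q div 24) * z ^ (q mod 24)"
      by (simp only: power_add power_mult)
    finally show ?thesis by (simp add: assms)
  qed
  show "z ^ q = z" if "q mod 24 = 1" using mod that by simp
  have "z \<noteq> 0" using assms by auto
  moreover have "z ^ 23 * z = 1" using assms by Groebner_Basis.algebra
  ultimately show "z ^ q = 1 / z" if "q mod 24 = 23" using mod that by (simp add: field_simps)
qed

text \<open>
  A root \<open>z\<close> of the 24th cyclotomic polynomial \<open>X\<^sup>8 - X\<^sup>4 + 1\<close> gives \<open>\<surd>2 = z\<^sup>3 + z\<^sup>-\<^sup>3\<close> and
  \<open>\<surd>3 = z\<^sup>2 + z\<^sup>-\<^sup>2\<close> (twice the cosines of 45 and 30 degrees). Raising to the power \<open>q\<close> maps \<open>z\<close> to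
  \<open>z\<close> or \<open>1/z\<close>, so it fixes both sums.
\<close>

lemma exists_sqrt_2_3:
  assumes "CARD('a::finite_field) mod 24 \<in> {1, 23}"
  shows "\<exists>t::'a. t\<^sup>2 = 2" and "\<exists>r::'a. r\<^sup>2 = 3"
proof -
  let ?q = "CARD('a)"
  obtain z :: "'a alg_closure" where "poly [:1, 0, 0, 0, -1, 0, 0, 0, 1:] z = 0"
    using alg_closed_imp_poly_has_root[of "[:1, 0, 0, 0, -1, 0, 0, 0, 1 :: 'a alg_closure:]"] by auto
  hence cyc: "z ^ 8 - z ^ 4 + 1 = 0" by (simp add: algebra_simps eval_nat_numeral)
  have z24: "z ^ 24 = 1" using cyc by Groebner_Basis.algebra
  define v where "v = 1 / z"
  have "z \<noteq> 0" using cyc by auto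
  hence zv: "z * v = 1" by (simp add: v_def)
  have fix_sum: "(z ^ k + v ^ k) ^ ?q = z ^ k + v ^ k" for k
  proof -
    have "(z ^ k + v ^ k) ^ ?q = (z ^ ?q) ^ k + (v ^ ?q) ^ k"
      by (simp add: pow_card_add power_mult[symmetric] mult.commute)
    moreover have "z ^ ?q = z \<and> v ^ ?q = v \<or> z ^ ?q = v \<and> v ^ ?q = z"
      using power_cong_24[OF z24, of ?q] assms by (auto simp: v_def power_divide)
    ultimately show ?thesis by auto
  qed
  obtain t where t: "z ^ 3 + v ^ 3 = to_ac t"
    using in_range_to_ac_if_pow_card_eq[OF fix_sum] by auto
  obtain r where r: "z\<^sup>2 + v\<^sup>2 = to_ac r"
    using in_range_to_ac_if_pow_card_eq[OF fix_sum] by auto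
  have "(z ^ 3 + v ^ 3)\<^sup>2 = 2" using cyc zv by Groebner_Basis.algebra
  hence "to_ac (t\<^sup>2) = to_ac 2" using t by simp
  thus "\<exists>t::'a. t\<^sup>2 = 2" by (metis to_ac_eq_iff)
  have "(z\<^sup>2 + v\<^sup>2)\<^sup>2 = 3" using cyc zv by Groebner_Basis.algebra
  hence "to_ac (r\<^sup>2) = to_ac 3" using r by simp
  thus "\<exists>r::'a. r\<^sup>2 = 3" by (metis to_ac_eq_iff)
qed

text \<open>
  If \<open>x\<^sup>2 = 3\<close> and \<open>t\<^sup>2 = 2\<close>, then \<open>(2 + x)/4\<close> is the square of \<open>(1 + x)/(2t)\<close>; this is used for
  \<open>x = r\<close> and, to treat \<open>1 - (2 + r)/4\<close>, for \<open>x = - r\<close>.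
\<close>

lemma in_C_set:
  fixes r t :: "'a::finite_field"
  assumes r: "r\<^sup>2 = 3" and t: "t\<^sup>2 = 2" and 2: "(2::'a) \<noteq> 0"
  shows "(2 + r) / 4 \<in> C_set"
proof -
  have 4: "(4::'a) \<noteq> 0" by (rule four_neq_0[OF 2])
  have t0: "t \<noteq> 0" using t 2 by auto
  have r1: "1 + x \<noteq> 0" if "x\<^sup>2 = 3" for x :: 'a
  proof
    assume "1 + x = 0"
    hence "x = - 1" by (simp add: add_eq_0_iff)
    hence "(1 + 2 :: 'a) = 1 + 0" using that by simp
    thus False using 2 by (simp only: add_left_cancel)
  qed
  have sq: "((1 + x) / (2 * t))\<^sup>2 = (2 + x) / 4 \<and> (2 + x) / 4 \<noteq> 0" if x: "x\<^sup>2 = 3" for x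
  proof -
    have *: "(1 + x)\<^sup>2 = 2 * (2 + x)" by (simp add: power2_sum x algebra_simps)
    have "((1 + x) / (2 * t))\<^sup>2 = (2 * (2 + x)) / (4 * 2)"
      by (simp add: power_divide * power_mult_distrib t)
    also have "\<dots> = (2 + x) / 4"
      by (rule mult_divide_mult_cancel_left[OF 2, of "2 + x" 4, unfolded mult.commute[of 2 4]])
    finally have "((1 + x) / (2 * t))\<^sup>2 = (2 + x) / 4" .
    moreover have "((1 + x) / (2 * t))\<^sup>2 \<noteq> 0" using r1[OF x] 2 t0 by simp
    ultimately show ?thesis by (metis)
  qed
  have char: "quadratic_character ((2 + x) / 4) = 1" if "x\<^sup>2 = 3" for x :: 'a
    unfolding quadratic_character_def using sq[OF that] by presburger
  have "1 - (2 + r) / 4 = (4 - (2 + r)) / 4" by (simp only: diff_divide_distrib divide_self[OF 4])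
  also have "4 - (2 + r) = 2 + (- r)" by Groebner_Basis.algebra
  finally have "1 - (2 + r) / 4 = (2 + (- r)) / 4" .
  moreover have "quadratic_character ((2 + (- r)) / 4) = 1" by (rule char) (simp add: r)
  ultimately show ?thesis unfolding C_set_def using char[OF r] by (metis (mono_tags, lifting) mem_Collect_eq)
qed

section \<open>The polynomial of degree 12\<close>

text \<open>
  The Dickson polynomial \<open>D\<^sub>1\<^sub>2(4X - 2)/4\<^sup>1\<^sup>2\<close> without its constant term, where \<open>D\<^sub>1\<^sub>2\<close> is the polynomial
  with \<open>D\<^sub>1\<^sub>2(u + 1/u) = u\<^sup>1\<^sup>2 + u\<^sup>-\<^sup>1\<^sup>2\<close>.
\<close>

definition dickson12 :: "'a::field poly" where
  "dickson12 = (let y = [:0, 1:] in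
              y ^ 12 - [:6:] * y ^ 11 + [:63/4:] * y ^ 10 - [:95/4:] * y ^ 9
            + [:2907/128:] * y ^ 8 - [:459/32:] * y ^ 7 + [:1547/256:] * y ^ 6
            - [:429/256:] * y ^ 5 + [:19305/65536:] * y ^ 4 - [:1001/32768:] * y ^ 3
            + [:429/262144:] * y ^ 2 - [:9/262144:] * y)"

lemma dickson12_eq:
  "(dickson12 :: 'a::field poly) =
    [:0, -9/262144, 429/262144, -1001/32768, 19305/65536, -429/256, 1547/256, -459/32,
      2907/128, -95/4, 63/4, -6, 1:]"
  by (simp add: dickson12_def Let_def eval_nat_numeral)

text \<open>
  As \<open>4 cosq u - 2 = u + 1/u\<close>, the polynomial \<open>D\<^sub>1\<^sub>2\<close> can be evaluated by squaring twice and cubing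
  once: \<open>D\<^sub>2 = a\<^sup>2 - 2\<close> and \<open>D\<^sub>3 = a\<^sup>3 - 3a\<close>. Here \<open>16777216 = 4\<^sup>1\<^sup>2\<close>, and the summand \<open>-2\<close> removes the constant
  term \<open>D\<^sub>1\<^sub>2(-2) = 2\<close>.
\<close>

lemma poly_dickson12_cosq:
  fixes u :: "'a::finite_field alg_closure"
  assumes 2: "(2 :: 'a alg_closure) \<noteq> 0" and u: "u \<noteq> 0"
  shows "poly (map_poly to_ac dickson12) (cosq u) = (u ^ 12 + 1 / u ^ 12 - 2) / 16777216"
proof -
  have nz: "(4::'a alg_closure) \<noteq> 0" "(32::'a alg_closure) \<noteq> 0" "(128::'a alg_closure) \<noteq> 0"
     "(256::'a alg_closure) \<noteq> 0" "(32768::'a alg_closure) \<noteq> 0" "(65536::'a alg_closure) \<noteq> 0"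
     "(262144::'a alg_closure) \<noteq> 0" "(16777216::'a alg_closure) \<noteq> 0"
    using power_not_zero[OF 2, of 2] power_not_zero[OF 2, of 5] power_not_zero[OF 2, of 7]
      power_not_zero[OF 2, of 8] power_not_zero[OF 2, of 15] power_not_zero[OF 2, of 16]
      power_not_zero[OF 2, of 18] power_not_zero[OF 2, of 24] by simp_all
  define v where "v = 1 / u"
  define x where "x = cosq u"
  have uv: "u * v = 1" using u by (simp add: v_def)
  define a where "a = 4 * x - 2"
  have "4 * cosq u = 2 + u + 1 / u"
    unfolding cosq_def using nz(1)
    by (rule nonzero_mult_div_cancel_left[THEN trans[OF times_divide_eq_right]])
  hence a: "a = u + v" by (simp add: a_def x_def v_def)
  have a2: "a\<^sup>2 - 2 = u\<^sup>2 + v\<^sup>2" using a uv by Groebner_Basis.algebra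
  have a4: "(a\<^sup>2 - 2)\<^sup>2 - 2 = u ^ 4 + v ^ 4" using a2 uv by Groebner_Basis.algebra
  have a12: "((a\<^sup>2 - 2)\<^sup>2 - 2) ^ 3 - 3 * ((a\<^sup>2 - 2)\<^sup>2 - 2) = u ^ 12 + v ^ 12"
    unfolding a4 using uv by Groebner_Basis.algebra
  (* The coefficients are kept opaque until they are cleared of denominators by 4^12. *)
  define c1 and c2 and c3 and c4 and c5 and c6 and c7 and c8 and c9 and c10
    where c_def: "c1 = (9/262144 :: 'a alg_closure)" "c2 = (429/262144 :: 'a alg_closure)"
      "c3 = (1001/32768 :: 'a alg_closure)" "c4 = (19305/65536 :: 'a alg_closure)"
      "c5 = (429/256 :: 'a alg_closure)" "c6 = (1547/256 :: 'a alg_closure)"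
      "c7 = (459/32 :: 'a alg_closure)" "c8 = (2907/128 :: 'a alg_closure)"
      "c9 = (95/4 :: 'a alg_closure)"
      "c10 = (63/4 :: 'a alg_closure)"
  have c: "16777216 * c1 = 576" "16777216 * c2 = 27456"
      "16777216 * c3 = 512512" "16777216 * c4 = 4942080"
      "16777216 * c5 = 28114944" "16777216 * c6 = 101384192"
      "16777216 * c7 = 240648192" "16777216 * c8 = 381026304"
      "16777216 * c9 = 398458880" "16777216 * c10 = 264241152"
    unfolding c_def using nz by (simp_all add: divide_eq_eq)
  have horner: "poly (map_poly to_ac dickson12) x = x * (- c1 + x * (c2 + x * (- c3 + x * (c4
      + x * (- c5 + x * (c6 + x * (- c7 + x * (c8 + x * (- c9 + x * (c10 + x * (- 6 + x)))))))))))"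
    by (simp add: dickson12_eq c_def)
  have expand: "k * poly (map_poly to_ac dickson12) x =
      k * x ^ 12 - 6 * k * x ^ 11 + (k * c10) * x ^ 10 - (k * c9) * x ^ 9
      + (k * c8) * x ^ 8 - (k * c7) * x ^ 7 + (k * c6) * x ^ 6
      - (k * c5) * x ^ 5 + (k * c4) * x ^ 4 - (k * c3) * x ^ 3 + (k * c2) * x ^ 2 - (k * c1) * x" for k
    unfolding horner by (simp add: algebra_simps eval_nat_numeral)
  have "16777216 * poly (map_poly to_ac dickson12) x =
     16777216 * x ^ 12 - 100663296 * x ^ 11 + 264241152 * x ^ 10 - 398458880 * x ^ 9
     + 381026304 * x ^ 8 - 240648192 * x ^ 7 + 101384192 * x ^ 6 - 28114944 * x ^ 5
     + 4942080 * x ^ 4 - 512512 * x ^ 3 + 27456 * x ^ 2 - 576 * x"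
    unfolding expand c by simp
  also have "\<dots> = ((a\<^sup>2 - 2)\<^sup>2 - 2) ^ 3 - 3 * ((a\<^sup>2 - 2)\<^sup>2 - 2) - 2"
    unfolding a_def by Groebner_Basis.algebra
  also have "\<dots> = u ^ 12 + v ^ 12 - 2" using a12 by simp
  finally show ?thesis
    using nz by (simp add: x_def v_def power_divide field_simps)
qed

section \<open>The conjugates of a root\<close>

text \<open>
  The \<open>q\<close>-th power of a root is a root. Under \<open>frob\<close> the \<open>q\<close>-th power of \<open>\<eta>\<^sup>j w\<close> is \<open>\<eta>\<^sup>j\<^sup>+\<^sup>1 w\<close> or its inverse,
  and \<open>cosq\<close> does not distinguish these two.
\<close>

lemma conjugates_of_root:
  fixes w \<eta> :: "'a::finite_field alg_closure" and p :: "'a poly"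
  assumes root: "poly (map_poly to_ac p) (cosq w) = 0"
    and frob: "(w ^ CARD('a) = \<eta> * w \<and> \<eta> ^ CARD('a) = \<eta>) \<or>
       (w ^ CARD('a) = 1 / (\<eta> * w) \<and> \<eta> ^ CARD('a) = 1 / \<eta>)"
  shows "poly (map_poly to_ac p) (cosq (\<eta> ^ j * w)) = 0"
proof (induction j)
  case (Suc j)
  let ?q = "CARD('a)"
  have "(\<eta> ^ j * w) ^ ?q = (\<eta> ^ ?q) ^ j * w ^ ?q"
    by (simp add: power_mult_distrib power_mult[symmetric] mult.commute)
  hence "(\<eta> ^ j * w) ^ ?q = \<eta> ^ Suc j * w \<or> (\<eta> ^ j * w) ^ ?q = 1 / (\<eta> ^ Suc j * w)"
    using frob by (auto simp: power_divide mult_ac)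
  hence "cosq (\<eta> ^ Suc j * w) = cosq (\<eta> ^ j * w) ^ ?q"
    by (metis cosq_pow_card cosq_inverse)
  hence "poly (map_poly to_ac p) (cosq (\<eta> ^ Suc j * w)) =
      poly (map_poly to_ac p) (cosq (\<eta> ^ j * w)) ^ ?q"
    by (metis poly_pow_card)
  thus ?case using Suc by (simp add: power_0_left)
qed (use root in simp)

text \<open>
  Two equal values give \<open>\<eta>\<^sup>j\<^sup>-\<^sup>i = 1\<close>, against the order of \<open>\<eta>\<close>, or \<open>\<eta>\<^sup>i\<^sup>+\<^sup>j w\<^sup>2 = 1\<close>. The latter implies
  \<open>w\<^sup>2\<^sup>4 = 1\<close>; but then \<open>w\<^sup>q\<close> is \<open>w\<close> or \<open>1/w\<close>, whereas \<open>frob\<close> has the additional factor \<open>\<eta> \<noteq> 1\<close>.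
\<close>

lemma inj_on_conjugates:
  fixes w \<eta> :: "'a::finite_field alg_closure"
  assumes 2: "(2 :: 'a alg_closure) \<noteq> 0" and 3: "(3 :: 'a alg_closure) \<noteq> 0"
    and w: "w \<noteq> 0" and cyc: "\<eta> ^ 4 - \<eta>\<^sup>2 + 1 = 0"
    and frob: "(CARD('a) mod 24 = 1 \<and> w ^ CARD('a) = \<eta> * w) \<or>
       (CARD('a) mod 24 = 23 \<and> w ^ CARD('a) = 1 / (\<eta> * w))"
  shows "inj_on (\<lambda>j. cosq (\<eta> ^ j * w)) {..<12}"
proof -
  have eta0: "\<eta> \<noteq> 0" using cyc by auto
  have eta1: "\<eta> \<noteq> 1" using cyclotomic_12_power_neq_1[OF cyc 2 3, of 1] by simp
  have w24: "w ^ 24 \<noteq> 1"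
  proof
    assume "w ^ 24 = 1"
    note power_cong_24[OF this, of "CARD('a)"]
    with frob w eta0 eta1 show False by (auto simp: field_simps)
  qed
  have neq: "cosq (\<eta> ^ i * w) \<noteq> cosq (\<eta> ^ j * w)" if ij: "i < j" "j < 12" for i j
  proof
    assume "cosq (\<eta> ^ i * w) = cosq (\<eta> ^ j * w)"
    hence "\<eta> ^ i * w = \<eta> ^ j * w \<or> (\<eta> ^ i * w) * (\<eta> ^ j * w) = 1"
      by (subst (asm) cosq_eq_iff) (use 2 w eta0 in auto)
    thus False
    proof
      assume "\<eta> ^ i * w = \<eta> ^ j * w"
      moreover have "\<eta> ^ j = \<eta> ^ i * \<eta> ^ (j - i)"
        using ij by (simp add: power_add[symmetric])
      ultimately have "\<eta> ^ (j - i) = 1" using w eta0 by simp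
      thus False using cyclotomic_12_power_neq_1[OF cyc 2 3, of "j - i"] ij by simp
    next
      assume "(\<eta> ^ i * w) * (\<eta> ^ j * w) = 1"
      hence "\<eta> ^ (i + j) * w\<^sup>2 = 1" by (simp add: power_add power2_eq_square mult_ac)
      hence "(\<eta> ^ (i + j) * w\<^sup>2) ^ 12 = 1" by simp
      hence "(\<eta> ^ 12) ^ (i + j) * w ^ 24 = 1"
        by (simp add: power_mult_distrib power_mult[symmetric] mult.commute)
      thus False using w24 by (simp add: cyclotomic_12_power[OF cyc])
    qed
  qed
  show ?thesis
    by (rule linorder_inj_onI) (use neq in auto)
qed

lemma frobenius_order_12:
  fixes w \<eta> :: "'a::finite_field alg_closure"
  assumes cyc: "\<eta> ^ 4 - \<eta>\<^sup>2 + 1 = 0"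
    and frob: "(CARD('a) mod 24 = 1 \<and> w ^ CARD('a) = \<eta> * w) \<or>
      (CARD('a) mod 24 = 23 \<and> w ^ CARD('a) = 1 / (\<eta> * w))"
  shows "(w ^ CARD('a) = \<eta> * w \<and> \<eta> ^ CARD('a) = \<eta>) \<or>
    (w ^ CARD('a) = 1 / (\<eta> * w) \<and> \<eta> ^ CARD('a) = 1 / \<eta>)"
proof -
  have "\<eta> ^ 24 = (\<eta> ^ 12)\<^sup>2" by (simp add: power_mult[symmetric])
  hence "\<eta> ^ 24 = 1" by (simp add: cyclotomic_12_power[OF cyc])
  from power_cong_24[OF this, of "CARD('a)"] frob show ?thesis by blast
qed

lemma degree_ge_12_if_root:
  fixes w \<eta> :: "'a::finite_field alg_closure" and p :: "'a poly"
  assumes 2: "(2 :: 'a alg_closure) \<noteq> 0" and 3: "(3 :: 'a alg_closure) \<noteq> 0"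
    and w0: "w \<noteq> 0" and cyc: "\<eta> ^ 4 - \<eta>\<^sup>2 + 1 = 0"
    and frob: "(CARD('a) mod 24 = 1 \<and> w ^ CARD('a) = \<eta> * w) \<or>
       (CARD('a) mod 24 = 23 \<and> w ^ CARD('a) = 1 / (\<eta> * w))"
    and p: "p \<noteq> 0" "poly (map_poly to_ac p) (cosq w) = 0"
  shows "12 \<le> degree p"
proof -
  let ?p = "map_poly to_ac p"
  have p0: "?p \<noteq> 0" using p by simp
  have "(\<lambda>j. cosq (\<eta> ^ j * w)) ` {..<12} \<subseteq> {x. poly ?p x = 0}"
    using conjugates_of_root[OF p(2) frobenius_order_12[OF cyc frob]] by auto
  hence "card ((\<lambda>j. cosq (\<eta> ^ j * w)) ` {..<12::nat}) \<le> card {x. poly ?p x = 0}"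
    by (intro card_mono poly_roots_finite p0)
  also have "\<dots> \<le> degree ?p" by (rule card_poly_roots_bound[OF p0])
  finally show ?thesis
    using inj_on_conjugates[OF 2 3 w0 cyc frob] by (simp add: card_image)
qed

lemma poly_dickson12_in_base_field:
  fixes w \<eta> :: "'a::finite_field alg_closure"
  assumes 2: "(2 :: 'a alg_closure) \<noteq> 0" and w0: "w \<noteq> 0" and cyc: "\<eta> ^ 4 - \<eta>\<^sup>2 + 1 = 0"
    and frob: "(CARD('a) mod 24 = 1 \<and> w ^ CARD('a) = \<eta> * w) \<or>
       (CARD('a) mod 24 = 23 \<and> w ^ CARD('a) = 1 / (\<eta> * w))"
  obtains m where "poly (map_poly to_ac dickson12) (cosq w) = to_ac m"
proof -
  let ?q = "CARD('a)"
  define M where "M = poly (map_poly to_ac dickson12) (cosq w)"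
  have "(w ^ 12) ^ ?q = (w ^ ?q) ^ 12" by (simp add: power_mult[symmetric] mult.commute)
  hence "(w ^ 12) ^ ?q = w ^ 12 \<or> (w ^ 12) ^ ?q = 1 / w ^ 12"
    using frobenius_order_12[OF cyc frob] cyclotomic_12_power[OF cyc] by (auto simp: power_divide power_mult_distrib)
  hence "(w ^ 12 + 1 / w ^ 12) ^ ?q = w ^ 12 + 1 / w ^ 12"
    by (auto simp: pow_card_add power_divide add.commute)
  hence "M ^ ?q = M"
    unfolding M_def poly_dickson12_cosq[OF 2 w0]
    by (simp add: power_divide pow_card_diff numeral_pow_card)
  thus ?thesis using that in_range_to_ac_if_pow_card_eq[of M] by (auto simp: M_def)
qed

section \<open>Roots and irreducible factors of the polynomial\<close>

text \<open>
  Suppose \<open>6 = 0\<close>. As \<open>q\<close> is 1 or 5 modulo 6, the equation \<open>q = 0\<close> in the field becomes \<open>1 = 0\<close> or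
  \<open>5 = 0\<close>, and the latter gives \<open>1 = 6 - 5 = 0\<close> as well.
\<close>

lemma two_three_neq_0:
  assumes "CARD('a::finite_field) mod 24 \<in> {1, 23}"
  shows "(2::'a) \<noteq> 0" and "(3::'a) \<noteq> 0"
proof -
  let ?q = "CARD('a)"
  have q0: "of_nat ?q = (0 :: 'a)" by (rule of_nat_CARD_eq_0)
  have 6: "(6::'a) \<noteq> 0"
  proof
    assume 6: "(6::'a) = 0"
    have "?q mod 6 = ?q mod 24 mod 6" by (simp add: mod_mod_cancel)
    hence "?q mod 6 = 1 \<or> ?q mod 6 = 5" using assms by auto
    moreover have "of_nat ?q = (of_nat (6 * (?q div 6) + ?q mod 6) :: 'a)" by simp
    hence "of_nat ?q = 6 * of_nat (?q div 6) + (of_nat (?q mod 6) :: 'a)"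
      by (simp only: of_nat_add of_nat_mult of_nat_numeral)
    ultimately have "(1::'a) = 0 \<or> (5::'a) = 0" using 6 q0 by auto
    moreover have "(6::'a) = 5 + 1" by simp
    ultimately show False using 6 by auto
  qed
  have "(6::'a) = 2 * 3" by simp
  thus "(2::'a) \<noteq> 0" and "(3::'a) \<noteq> 0" using 6 by (metis mult_zero_left, metis mult_zero_right)
qed

lemma two_three_neq_0_alg_closure:
  assumes "CARD('a::finite_field) mod 24 \<in> {1, 23}"
  shows "(2::'a alg_closure) \<noteq> 0" and "(3::'a alg_closure) \<noteq> 0"
proof -
  have "to_ac (2::'a) \<noteq> 0" "to_ac (3::'a) \<noteq> 0"
    using two_three_neq_0[OF assms] by (simp_all only: to_ac_eq_0_iff not_False_eq_True)
  thus "(2::'a alg_closure) \<noteq> 0" and "(3::'a alg_closure) \<noteq> 0" by simp_all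
qed

lemma mod_24_half:
  assumes "q mod 24 = 1 \<or> q mod 24 = (23::nat)"
  shows "2 * ((q + 1) div 2) = q + 1" and "even ((q + 1) div 2) \<longleftrightarrow> q mod 24 = 23"
  using assms by presburger+

lemma int_cong_1_minus_1_mod_24:
  assumes "[int q = 1] (mod 24) \<or> [int q = - 1] (mod 24)"
  shows "q mod 24 \<in> {1, 23}"
proof -
  have "int q mod 24 = 1 \<or> int q mod 24 = 23" using assms by (simp add: cong_def)
  hence "int (q mod 24) = 1 \<or> int (q mod 24) = 23" by (simp add: zmod_int)
  thus ?thesis by auto
qed

text \<open>
  Here \<open>z\<close> with \<open>z + 1/z = 2s\<close> is read off from \<open>sum_of_powers_at_cosq_square\<close>. Squaring twice,
  \<open>4s\<^sup>2 = 2 - r\<close> gives \<open>z\<^sup>2 + z\<^sup>-\<^sup>2 = - r\<close> and \<open>z\<^sup>4 + z\<^sup>-\<^sup>4 = r\<^sup>2 - 2 = 1\<close>, which is the cyclotomic equation for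
  \<open>\<eta> = z\<^sup>2\<close>. The congruence of \<open>q\<close> modulo 24 determines the parity of \<open>n\<close>.
\<close>

lemma root_of_g_poly_cosq:
  fixes r s :: "'a::finite_field"
  assumes q: "CARD('a) mod 24 \<in> {1, 23}" and r: "r\<^sup>2 = 3" and s: "1 - s\<^sup>2 = (2 + r) / 4"
    and y: "poly (map_poly to_ac (g_poly s)) y = 0"
  obtains w \<eta> where "w \<noteq> 0" and "y = cosq w" and "\<eta> ^ 4 - \<eta>\<^sup>2 + 1 = 0"
    and "(CARD('a) mod 24 = 1 \<and> w ^ CARD('a) = \<eta> * w) \<or>
      (CARD('a) mod 24 = 23 \<and> w ^ CARD('a) = 1 / (\<eta> * w))"
proof -
  let ?q = "CARD('a)"
  have 2: "(2::'a alg_closure) \<noteq> 0" by (rule two_three_neq_0_alg_closure(1)[OF q])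
  have four: "(4::'a) \<noteq> 0" by (rule four_neq_0[OF two_three_neq_0(1)[OF q]])
  obtain e where e: "e \<noteq> 0" and ye: "y = cosq (e\<^sup>2)"
    using exists_cosq_square[OF 2, of y] by blast
  define E where "E = e ^ ?q"
  have E0: "E \<noteq> 0" using e by (simp add: E_def)
  define n where "n = (?q + 1) div 2"
  have n: "2 * n = ?q + 1" and n_parity: "even n \<longleftrightarrow> ?q mod 24 = 23"
    using mod_24_half[of ?q] q unfolding n_def by auto

  have ys: "y ^ n + (1 - y) ^ n = to_ac s"
    using y by (simp add: g_poly_def Let_def n_def)
  (* Only z + 1/z matters so far; of the two choices for z this is the one for which
     cosq w ^ q = cosq (\<eta> * w) holds in both cases. *)
  define z where "z = (if even n then 1 / (e * E) else E / e)"
  have z0: "z \<noteq> 0" using e E0 by (simp add: z_def)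
  define v where "v = 1 / z"
  have zv: "z * v = 1" using z0 by (simp add: v_def)
  have s_zv: "2 * to_ac s = z + v"
    using sum_of_powers_at_cosq_square[OF 2 n e]
    unfolding ye[symmetric] E_def[symmetric] ys by (simp add: z_def v_def add.commute)

  have "4 * (1 - s\<^sup>2) = 2 + r" unfolding s using four by simp
  hence "2 + (2 - 4 * s\<^sup>2) = 2 + r" by (simp add: algebra_simps)
  hence "2 - 4 * s\<^sup>2 = r" by (simp only: add_left_cancel)
  hence "4 * s\<^sup>2 = 2 - r" by (simp add: algebra_simps)
  hence "to_ac (4 * s\<^sup>2) = to_ac (2 - r)" by simp
  hence "(2 * to_ac s)\<^sup>2 = 2 - to_ac r" by (simp add: power_mult_distrib)
  hence "z\<^sup>2 + v\<^sup>2 = - to_ac r" using zv unfolding s_zv by Groebner_Basis.algebra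
  moreover have "(to_ac r)\<^sup>2 = 3" using r by (metis to_ac_numeral to_ac_power)
  ultimately have "z ^ 4 + v ^ 4 = 1" using zv by Groebner_Basis.algebra
  hence z8: "z ^ 8 - z ^ 4 + 1 = 0" using zv by Groebner_Basis.algebra
  define \<eta> where "\<eta> = z\<^sup>2"
  have cyc: "\<eta> ^ 4 - \<eta>\<^sup>2 + 1 = 0" using z8 by (simp add: \<eta>_def power_mult[symmetric])

  define w where "w = e\<^sup>2"
  have w0: "w \<noteq> 0" using e by (simp add: w_def)
  have wq: "w ^ ?q = E\<^sup>2" by (simp add: w_def E_def power_mult[symmetric] mult.commute)
  have frob: "(?q mod 24 = 1 \<and> w ^ ?q = \<eta> * w) \<or> (?q mod 24 = 23 \<and> w ^ ?q = 1 / (\<eta> * w))"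
  proof (cases "even n")
    case True
    thus ?thesis using n_parity e E0 unfolding wq
      by (simp add: w_def \<eta>_def z_def power_divide power_mult_distrib)
  next
    case False
    thus ?thesis using n_parity q e E0 unfolding wq by (simp add: w_def \<eta>_def z_def power_divide)
  qed
  show ?thesis using that[OF w0 _ cyc frob] by (simp add: ye w_def)
qed

lemma irreducible_factor_eq_dickson12:
  fixes r s :: "'a::finite_field" and I :: "'a poly"
  assumes q: "CARD('a) mod 24 \<in> {1, 23}" and r: "r\<^sup>2 = 3" and s: "1 - s\<^sup>2 = (2 + r) / 4"
    and I: "lead_coeff I = 1" "Factorial_Ring.irreducible I" "I dvd g_poly s"
  shows "\<exists>m. I = dickson12 - [:m:]"
proof -
  note nz = two_three_neq_0_alg_closure[OF q]
  have "degree (map_poly to_ac I) > 0"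
    using I(2) is_unit_iff_degree[of I] by (auto simp: irreducible_def)
  then obtain y where y: "poly (map_poly to_ac I) y = 0"
    using alg_closed_imp_poly_has_root by blast
  obtain h where "g_poly s = I * h" using I(3) by blast
  hence "poly (map_poly to_ac (g_poly s)) y = 0" using y by simp
  then obtain w \<eta> where w: "w \<noteq> 0" "y = cosq w" and cyc: "\<eta> ^ 4 - \<eta>\<^sup>2 + 1 = 0"
    and frob: "(CARD('a) mod 24 = 1 \<and> w ^ CARD('a) = \<eta> * w) \<or>
      (CARD('a) mod 24 = 23 \<and> w ^ CARD('a) = 1 / (\<eta> * w))"
    by (rule root_of_g_poly_cosq[OF q r s])
  obtain m where m: "poly (map_poly to_ac dickson12) (cosq w) = to_ac m"
    by (rule poly_dickson12_in_base_field[OF nz(1) w(1) cyc frob])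
  have deg: "degree (dickson12 - [:m:]) = 12" "lead_coeff (dickson12 - [:m:]) = 1"
    by (simp_all add: dickson12_eq)
  have "I = dickson12 - [:m:]"
  proof (rule eq_if_common_root_of_min_degree[OF I(2,1) deg(2) _ y])
    show "poly (map_poly to_ac (dickson12 - [:m:])) y = 0"
      using m by (simp add: w(2))
    show "degree (dickson12 - [:m:]) \<le> degree p"
      if "p \<noteq> 0" "poly (map_poly to_ac p) y = 0" for p :: "'a poly"
      unfolding deg(1) by (rule degree_ge_12_if_root[OF nz w(1) cyc frob that[unfolded w(2)]])
  qed (simp add: deg)
  thus ?thesis ..
qed

theorem corollary4p12:
  fixes q :: nat
  assumes "q = CARD('a::finite_field)"
    and "[int q = 1] (mod 24) \<or> [int q = - 1] (mod 24)"
  shows "(\<exists>t::'a. t\<^sup>2 = 2) \<and> (\<exists>r::'a. r\<^sup>2 = 3) \<and>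
    (\<forall>(r::'a) c. r\<^sup>2 = 3 \<longrightarrow> c = (2 + r) / 4 \<longrightarrow>
      c \<in> C_set \<and>
      (\<forall>s. 1 - s\<^sup>2 = c \<longrightarrow>
        (\<forall>I :: 'a poly. lead_coeff I = 1 \<longrightarrow> Factorial_Ring.irreducible I \<longrightarrow> I dvd g_poly s \<longrightarrow>
          (\<exists>m::'a. let y = [:0, 1:] in I =
              y ^ 12 - [:6:] * y ^ 11 + [:63/4:] * y ^ 10 - [:95/4:] * y ^ 9
            + [:2907/128:] * y ^ 8 - [:459/32:] * y ^ 7 + [:1547/256:] * y ^ 6
            - [:429/256:] * y ^ 5 + [:19305/65536:] * y ^ 4 - [:1001/32768:] * y ^ 3
            + [:429/262144:] * y ^ 2 - [:9/262144:] * y - [:m:]))))"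
proof -
  have q: "CARD('a) mod 24 \<in> {1, 23}"
    using int_cong_1_minus_1_mod_24[OF assms(2)] unfolding assms(1) .
  obtain t :: 'a where t: "t\<^sup>2 = 2" using exists_sqrt_2_3[OF q] by blast
  show ?thesis
  proof (intro conjI allI impI exists_sqrt_2_3[OF q])
    fix r c :: 'a assume r: "r\<^sup>2 = 3" and c: "c = (2 + r) / 4"
    show "c \<in> C_set" unfolding c by (rule in_C_set[OF r t two_three_neq_0(1)[OF q]])
    fix s and I :: "'a poly"
    assume "1 - s\<^sup>2 = c" "lead_coeff I = 1" "Factorial_Ring.irreducible I" "I dvd g_poly s"
    from irreducible_factor_eq_dickson12[OF q r this[unfolded c]] show "\<exists>m. let y = [:0, 1:] in I =
              y ^ 12 - [:6:] * y ^ 11 + [:63/4:] * y ^ 10 - [:95/4:] * y ^ 9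
            + [:2907/128:] * y ^ 8 - [:459/32:] * y ^ 7 + [:1547/256:] * y ^ 6
            - [:429/256:] * y ^ 5 + [:19305/65536:] * y ^ 4 - [:1001/32768:] * y ^ 3
            + [:429/262144:] * y ^ 2 - [:9/262144:] * y - [:m:]"
      unfolding dickson12_def Let_def .
  qed
qed

end
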